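(* Let $(X,\models,A)$ be an I-topological system. Define a relation $\mathscr{R}$ on $X$ by $x\mathscr{R}y$ iff $p^*(x)\,R\,p^*(y)$, and define $v:X\times A\to\{0,1\}$ by $v(x,a)=1$ iff $x\models a$. Then $(X,\mathscr{R},v)$ is an intuitionistic Kripke model (with the elements of $A$ in the role of propositional variables and $\mathbf{0}\in A$ in the role of $\bot$).
   Context: A Heyting algebra is an algebra $(A,\vee,\wedge,\rightarrow,\mathbf{1},\mathbf{0})$ such that $(A,\vee,\wedge,\mathbf{1},\mathbf{0})$ is a bounded distributive lattice and $\rightarrow$ is a binary operation adjoint to $\wedge$ ($c\wedge a\le b$ iff $c\le a\rightarrow b$). $Hom(A,\{0,1\})$ denotes the set of all bounded distributive lattice homomorphisms from $A$ to the two-element algebra $\{0,1\}$, ordered pointwise: $h_1Rh_2$ iff $h_1(a)\le h_2(a)$ for all $a\in A$. An I-topological system is a triple $(X,\models,A)$ consisting of a nonempty set $X$, a Heyting algebra $A$ and a relation $\models$ from $X$ to $A$ such that: (1) $x\models\mathbf{0}$ for no $x\in X$; (2) $x\models a\wedge b$ iff $x\models a$ and $x\models b$; (3) $x\models a\vee b$ iff $x\models a$ or $x\models b$; (4) $x\models a\rightarrow b$ iff for all $y\in X$ such that $p^*(x)Rp^*(y)$, $y\not\models a$ or $y\models b$, where $p^*:X\to Hom(A,\{0,1\})$ is given by $p^*(x)(a)=1$ iff $x\models a$. A Kripke frame is a pair $(W,\mathscr{R})$ consisting of a nonempty set $W$ and a partial order relation $\mathscr{R}$ on $W$. An (intuitionistic)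 Kripke model is a Kripke frame $(W,\mathscr{R})$ together with a valuation map $v:W\times\mathbf{V}\to\{0,1\}$, where $\mathbf{V}$ is the set of propositional variables, such that: (1) for all $w\in W$ and all $p\in\mathbf{V}$, if $v(w,p)=1$ and $w\mathscr{R}u$ then $v(u,p)=1$; (2) $v(w,\bot)=0$ for all $w\in W$.
   Formalization: As stated the claim fails: two distinct points satisfying the same elements of A break antisymmetry. Proved instead: the relation is always a preorder, v always meets both valuation conditions, and the triple is a Kripke model (with partial order) iff p* is injective on X. *)

theory Defs
  imports Main
begin

class heyting_algebra = distrib_lattice + bounded_lattice +
  fixes himp :: "'a \<Rightarrow> 'a \<Rightarrow> 'a"
  assumes himp_adjoint: "inf c a \<le> b \<longleftrightarrow> c \<le> himp a b"

text \<open>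
  The two-element algebra is \<^typ>\<open>bool\<close> with its library lattice structure
  (\<^const>\<open>False\<close> is 0, \<^const>\<open>True\<close> is 1).
\<close>

definition lattice_homs :: "('a :: {distrib_lattice, bounded_lattice} \<Rightarrow> bool) set" where
  "lattice_homs = {h. h bot = bot \<and> h top = top \<and>
     (\<forall>a b. h (inf a b) = inf (h a) (h b)) \<and> (\<forall>a b. h (sup a b) = sup (h a) (h b))}"

definition hom_order ::
  "(('a :: {distrib_lattice, bounded_lattice} \<Rightarrow> bool) \<times> ('a \<Rightarrow> bool)) set" where
  "hom_order = {(h1, h2). h1 \<in> lattice_homs \<and> h2 \<in> lattice_homs \<and> (\<forall>a. h1 a \<le> h2 a)}"

definition p_star :: "('x \<Rightarrow> 'a \<Rightarrow> bool) \<Rightarrow> 'x \<Rightarrow> ('a \<Rightarrow> bool)" where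
  "p_star sat x = (\<lambda>a. sat x a)"

text \<open>
  The locale does not assume that \<^const>\<open>p_star\<close> maps into \<^const>\<open>lattice_homs\<close>: preservation
  of \<^const>\<open>top\<close> follows from \<open>sat_himp\<close>, applied to \<^term>\<open>himp bot bot\<close>, and \<open>sat_bot\<close>.
\<close>

locale I_topological_system =
  fixes X :: "'x set" and sat :: "'x \<Rightarrow> 'a :: heyting_algebra \<Rightarrow> bool"
  assumes nonempty: "X \<noteq> {}"
    and sat_bot: "\<And>x. x \<in> X \<Longrightarrow> \<not> sat x bot"
    and sat_inf: "\<And>x a b. x \<in> X \<Longrightarrow> sat x (inf a b) \<longleftrightarrow> sat x a \<and> sat x b"
    and sat_sup: "\<And>x a b. x \<in> X \<Longrightarrow> sat x (sup a b) \<longleftrightarrow> sat x a \<or> sat x b"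
    and sat_himp: "\<And>x a b. x \<in> X \<Longrightarrow> sat x (himp a b) \<longleftrightarrow>
      (\<forall>y\<in>X. (p_star sat x, p_star sat y) \<in> hom_order \<longrightarrow> \<not> sat y a \<or> sat y b)"

locale kripke_frame =
  fixes W :: "'w set" and R :: "('w \<times> 'w) set"
  assumes nonempty: "W \<noteq> {}"
    and partial_order: "partial_order_on W R"

text \<open>
  The type \<open>'p\<close> comprises the propositional variables together with an element \<open>falsum\<close>
  playing the role of falsity; persistence at \<open>falsum\<close> is implied by \<open>falsum_false\<close>.
\<close>

locale kripke_valuation =
  fixes W :: "'w set" and R :: "('w \<times> 'w) set" and v :: "'w \<times> 'p \<Rightarrow> bool" and falsum :: 'p
  assumes persistent: "\<And>w u p. w \<in> W \<Longrightarrow> u \<in> W \<Longrightarrow> v (w, p) \<Longrightarrow> (w, u) \<in> R \<Longrightarrow> v (u, p)"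
    and falsum_false: "\<And>w. w \<in> W \<Longrightarrow> \<not> v (w, falsum)"

locale kripke_model = kripke_frame W R + kripke_valuation W R v falsum
  for W :: "'w set" and R :: "('w \<times> 'w) set" and v :: "'w \<times> 'p \<Rightarrow> bool" and falsum :: 'p

text \<open>
  The induced relation is a partial order only if distinct points satisfy different elements
  of the algebra: for two points over the two-element Heyting algebra, both satisfying exactly
  \<^const>\<open>top\<close>, all axioms of \<open>I_topological_system\<close> hold, but antisymmetry fails.
\<close>

definition induced_rel :: "'x set \<Rightarrow> ('x \<Rightarrow> 'a :: heyting_algebra \<Rightarrow> bool) \<Rightarrow> ('x \<times> 'x) set" where
  "induced_rel X sat = {(x, y). x \<in> X \<and> y \<in> X \<and> (p_star sat x, p_star sat y) \<in> hom_order}"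

definition induced_val :: "('x \<Rightarrow> 'a \<Rightarrow> bool) \<Rightarrow> 'x \<times> 'a \<Rightarrow> bool" where
  "induced_val sat = (\<lambda>(x, a). sat x a)"

end

theory Submission
  imports Defs
begin

text \<open>Each \<open>p_star sat x\<close> is a lattice homomorphism, so
  \<open>induced_rel\<close> is the pullback along \<open>p_star sat\<close> of the pointwise order
  on functions (\<open>induced_rel_iff\<close>). A pullback of a partial order is a preorder, and it
  is antisymmetric exactly when the map is injective (\<open>antisym_induced_rel_iff\<close>).
  Persistence is the pointwise inequality itself, so injectivity alone decides whether the structure
  is a Kripke model.\<close>

context I_topological_system
begin

text \<open>By adjointness \<open>top\<close> equals \<open>himp bot bot\<close>, whose satisfaction
  clause asks only for the tautology \<open>\<not> sat y bot \<or> sat y bot\<close>.\<close>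

lemma sat_top:
  assumes "x \<in> X"
  shows "sat x top"
proof -
  have "himp bot bot = (top :: 'a)"
    using himp_adjoint[of top bot bot] by (simp add: top_unique)
  then show ?thesis
    using sat_himp[OF assms, of bot bot] sat_bot by simp
qed

lemma p_star_in_lattice_homs:
  assumes "x \<in> X"
  shows "p_star sat x \<in> lattice_homs"
  using assms by (simp add: lattice_homs_def p_star_def sat_bot sat_top sat_inf sat_sup)

text \<open>The homomorphism conditions inside \<open>hom_order\<close> hold automatically on
  \<open>X\<close>, which leaves the plain order of functions.\<close>

lemma induced_rel_iff:
  "(x, y) \<in> induced_rel X sat \<longleftrightarrow> x \<in> X \<and> y \<in> X \<and> p_star sat x \<le> p_star sat y"
  by (auto simp: induced_rel_def hom_order_def p_star_in_lattice_homs le_fun_def)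

lemma preorder_on_induced_rel: "preorder_on X (induced_rel X sat)"
  by (auto simp: preorder_on_def refl_on_def trans_def induced_rel_iff intro: order_trans)

text \<open>Points of \<open>X\<close> are related both ways exactly when \<open>p_star sat\<close>
  identifies them.\<close>

lemma antisym_induced_rel_iff: "antisym (induced_rel X sat) \<longleftrightarrow> inj_on (p_star sat) X"
proof
  assume anti: "antisym (induced_rel X sat)"
  show "inj_on (p_star sat) X"
  proof (rule inj_onI)
    fix x y
    assume "x \<in> X" "y \<in> X" "p_star sat x = p_star sat y"
    then show "x = y"
      by (intro antisymD[OF anti]) (simp_all add: induced_rel_iff)
  qed
next
  assume inj: "inj_on (p_star sat) X"
  show "antisym (induced_rel X sat)"
  proof (rule antisymI)
    fix x y
    assume "(x, y) \<in> induced_rel X sat" "(y, x) \<in> induced_rel X sat"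
    then show "x = y"
      by (intro inj_onD[OF inj]) (auto simp: induced_rel_iff)
  qed
qed

text \<open>Persistence at \<open>a\<close> is the inequality between \<open>p_star sat w\<close>
  and \<open>p_star sat u\<close> evaluated at \<open>a\<close>.\<close>

lemma kripke_valuation_induced:
  "kripke_valuation X (induced_rel X sat) (induced_val sat) bot"
  by unfold_locales (auto simp: induced_rel_iff induced_val_def p_star_def le_fun_def sat_bot)

lemma kripke_model_induced_iff:
  "kripke_model X (induced_rel X sat) (induced_val sat) bot \<longleftrightarrow> inj_on (p_star sat) X"
  using nonempty preorder_on_induced_rel kripke_valuation_induced
  by (simp add: kripke_model_def kripke_frame_def partial_order_on_def antisym_induced_rel_iff)

end

theorem theorem2:
  fixes X :: "'x set" and sat :: "'x \<Rightarrow> 'a :: heyting_algebra \<Rightarrow> bool"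
  assumes "I_topological_system X sat"
  shows "preorder_on X (induced_rel X sat) \<and>
    kripke_valuation X (induced_rel X sat) (induced_val sat) bot \<and>
    (kripke_model X (induced_rel X sat) (induced_val sat) bot \<longleftrightarrow> inj_on (p_star sat) X)"
proof -
  interpret I_topological_system X sat by (fact assms)
  show ?thesis
    using preorder_on_induced_rel kripke_valuation_induced kripke_model_induced_iff by blast
qed

end
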